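(* Let $\alpha,\beta>-1$ and $n\ge 0$. Let $x_0<x_1<\dots<x_n$ be the roots of the Jacobi polynomial $P_{n+1}^{(\alpha+1,\beta+1)}$. Let $\hat w_1,\hat w_2,\tilde w_0,\dots,\tilde w_n$ be the weights of the Gauss-Lobatto quadrature rule $$\int_{-1}^1(1-x)^\alpha(1+x)^\beta f(x)\,dx\simeq \hat w_1f(-1)+\hat w_2f(1)+\sum_{j=0}^n\tilde w_jf(x_j).$$ Consider the $n+3$ interpolation points $\{-1,1\}\cup\{x_j\}_{j=0}^n$; let $\tilde\lambda_j$ denote the barycentric weight belonging to $x_j$, and $\hat\lambda_1,\hat\lambda_2$ those belonging to $-1$ and $1$ respectively. Then $$\tilde\lambda_j=C_n^{(\alpha+1,\beta+1)}(-1)^{j+1}\sqrt{\tilde w_j},\qquad j=0,\dots,n,$$ $$\hat\lambda_1=C_n^{(\alpha+1,\beta+1)}\sqrt{(\beta+1)\hat w_1},\qquad \hat\lambda_2=C_n^{(\alpha+1,\beta+1)}(-1)^n\sqrt{(\alpha+1)\hat w_2},$$ where, for parameters $a,b$, $$C_n^{(a,b)}=\sigma\,\frac{\Gamma(2n+a+b+3)}{2^{\,n+1+\frac{a+b+1}{2}}}\,\frac{1}{\sqrt{(n+1)!\,\Gamma(n+a+b+2)\,\Gamma(n+a+2)\,\Gamma(n+b+2)}},$$ with $\sigma=+1$ for even $n$ and $\sigma=-1$ for odd $n$.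
   Context: The barycentric weight belonging to a point $z$ of a finite set $Z$ of interpolation points is $\prod_{y\in Z,\,y\ne z}(z-y)^{-1}$. The Gauss-Lobatto rule above is the quadrature rule with nodes $-1,1,x_0,\dots,x_n$ that is exact for all polynomials of degree at most $2n+3$. *)

theory Defs
  imports "HOL-Analysis.Analysis" "HOL-Computational_Algebra.Polynomial"
begin

(* The explicit (Szegoe) form of the Jacobi polynomial, equivalent to the Rodrigues formula;
   the normalisation is P_n^(a,b)(1) = (n + a) gchoose n. *)
definition jacobi_poly :: "nat \<Rightarrow> real \<Rightarrow> real \<Rightarrow> real poly" where
  "jacobi_poly n a b =
     smult (1 / 2 ^ n)
       (\<Sum>s\<le>n. smult (((real n + a) gchoose (n - s)) * ((real n + b) gchoose s))
                  ([:-1, 1:] ^ s * [:1, 1:] ^ (n - s)))"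

definition barycentric_weight :: "real set \<Rightarrow> real \<Rightarrow> real" where
  "barycentric_weight Z z = (\<Prod>y\<in>Z - {z}. inverse (z - y))"

(* Where alpha or beta is negative the integrand is unbounded at an endpoint; there powr returns 0,
   which does not affect the integral. *)
definition gauss_lobatto_rule ::
  "real \<Rightarrow> real \<Rightarrow> nat \<Rightarrow> (nat \<Rightarrow> real) \<Rightarrow> real \<Rightarrow> real \<Rightarrow> (nat \<Rightarrow> real) \<Rightarrow> bool" where
  "gauss_lobatto_rule \<alpha> \<beta> n x w1 w2 w \<longleftrightarrow>
     (\<forall>f :: real poly. degree f \<le> 2 * n + 3 \<longrightarrow>
        ((\<lambda>t. (1 - t) powr \<alpha> * (1 + t) powr \<beta> * poly f t) has_integral
           (w1 * poly f (-1) + w2 * poly f 1 + (\<Sum>j\<le>n. w j * poly f (x j)))) {-1..1})"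

definition bary_const :: "nat \<Rightarrow> real \<Rightarrow> real \<Rightarrow> real" where
  "bary_const n a b =
     (if even n then 1 else -1) *
     (Gamma (2 * real n + a + b + 3) / 2 powr (real n + 1 + (a + b + 1) / 2)) *
     (1 / sqrt (fact (n + 1) * Gamma (real n + a + b + 2) *
                Gamma (real n + a + 2) * Gamma (real n + b + 2)))"

end

theory Submission
  imports Defs
begin

text \<open>
  Put a = \<open>\<alpha> + 1\<close>, b = \<open>\<beta> + 1\<close> and let P be the Jacobi polynomial with roots \<open>x\<^sub>j\<close>.
  The operator \<open>L g = (1 - t\<^sup>2) g' + (b - a - (a + b) t) g\<close> satisfies
  \<open>(1 - t)\<^sup>\<alpha> (1 + t)\<^sup>\<beta> L g = ((1 - t)\<^sup>a (1 + t)\<^sup>b g)'\<close>, so the quadrature rule annihilates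
  \<open>L (P q)\<close> whenever q has degree at most n + 1.  Evaluated at the nodes this is a linear functional
  in q that is supported on the n + 3 nodes and kills all polynomials of degree at most n + 1; such a
  functional is a multiple of the divided difference, whose coefficients are the barycentric weights.
  As those are the inverses of the derivatives of \<open>(t\<^sup>2 - 1) P\<close> (up to the leading coefficient of P),
  comparing coefficients gives \<open>w\<^sub>j = c \<lambda>\<^sub>j\<^sup>2\<close> at the roots of P, and \<open>b w\<^sub>1 = c \<lambda>\<^sup>2\<close>,
  \<open>a w\<^sub>2 = c \<lambda>\<^sup>2\<close> at the endpoints, with one constant c.  Its value is read off from the
  weight at 1, obtained by applying the rule to (1 + t) P.  Positivity of the weights, together with
  the rule applied to \<open>(1 - t\<^sup>2) \<Prod>\<^sub>i\<^sub>\<noteq>\<^sub>j (t - x\<^sub>i)\<^sup>2\<close>, puts the roots inside the interval, which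
  settles the signs.
\<close>

section \<open>An alternating binomial sum and the Beta integral on [-1,1]\<close>

text \<open>This is the partial fraction expansion of N! / (x (x+1) ... (x+N)). By Pascal's rule the
  sum for N + 1 is the sum for N at x minus the one at x + 1.\<close>

lemma sum_alternating_binomial_divide:
  fixes x :: real
  assumes "x > 0"
  shows "(\<Sum>s\<le>N. (-1) ^ s * real (N choose s) / (x + real s)) = fact N / pochhammer x (N + 1)"
  using assms
proof (induction N arbitrary: x)
  case 0
  then show ?case by simp
next
  case (Suc N)
  define f where "f s = (-1) ^ s / (x + real s)" for s
  have "(\<Sum>s\<le>Suc N. (-1) ^ s * real (Suc N choose s) / (x + real s))
      = (\<Sum>s\<le>Suc N. real (Suc N choose s) * f s)"
    by (simp add: f_def mult.commute)
  also have "\<dots> = (f 0 + (\<Sum>s\<le>N. real (N choose Suc s) * f (Suc s)))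
      + (\<Sum>s\<le>N. real (N choose s) * f (Suc s))"
    by (subst sum.atMost_Suc_shift) (simp add: sum.distrib algebra_simps)
  also have "f 0 + (\<Sum>s\<le>N. real (N choose Suc s) * f (Suc s))
      = (\<Sum>s\<le>Suc N. real (N choose s) * f s)"
    by (subst sum.atMost_Suc_shift) simp
  also have "\<dots> = (\<Sum>s\<le>N. (-1) ^ s * real (N choose s) / (x + real s))"
    by (simp add: f_def mult.commute)
  also have "\<dots> = fact N / pochhammer x (N + 1)"
    by (rule Suc.IH) (fact Suc.prems)
  also have "(\<Sum>s\<le>N. real (N choose s) * f (Suc s))
      = - (\<Sum>s\<le>N. (-1) ^ s * real (N choose s) / ((x + 1) + real s))"
    by (simp add: f_def sum_negf [symmetric] mult.commute add_ac)
  also have "(\<Sum>s\<le>N. (-1) ^ s * real (N choose s) / ((x + 1) + real s))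
      = fact N / pochhammer (x + 1) (N + 1)"
    by (rule Suc.IH) (use Suc.prems in simp)
  also have "fact N / pochhammer x (N + 1) + - (fact N / pochhammer (x + 1) (N + 1))
      = fact (Suc N) / pochhammer x (Suc N + 1)"
  proof -
    have 1: "pochhammer x (N + 1) = x * pochhammer (x + 1) N"
      by (simp add: pochhammer_rec)
    have 2: "pochhammer (x + 1) (N + 1) = pochhammer (x + 1) N * (x + 1 + real N)"
      by (simp add: pochhammer_Suc)
    have 3: "pochhammer x (Suc N + 1) = x * (pochhammer (x + 1) N * (x + 1 + real N))"
      by (simp add: pochhammer_rec[of x "Suc N"] 2[simplified])
    have "pochhammer (x + 1) N > 0"
      by (rule pochhammer_pos) (use Suc.prems in simp)
    then show ?thesis
      unfolding 1 2 3 using Suc.prems by (simp add: divide_simps) (simp add: algebra_simps)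
  qed
  finally show ?case .
qed

text \<open>Euler's Beta integral under the substitution (1 + t) / 2; the scaling of the two powers
  and the Jacobian together give the exponent p + q + 1.\<close>

lemma has_integral_Beta_symmetric:
  fixes p q :: real
  assumes "p > -1" "q > -1"
  shows "((\<lambda>t. (1 - t) powr p * (1 + t) powr q) has_integral
           2 powr (p + q + 1) * Beta (p + 1) (q + 1)) {-1..1}"
proof -
  have "((\<lambda>t. t powr q * (1 - t) powr p) has_integral Beta (q + 1) (p + 1)) (cbox 0 1)"
    using has_integral_Beta_real[of "q + 1" "p + 1"] assms by simp
  from has_integral_affinity'[OF this, of "1/2" "1/2"]
  have "((\<lambda>t. (t / 2 + 1 / 2) powr q * (1 - (t / 2 + 1 / 2)) powr p) has_integral
          2 * Beta (q + 1) (p + 1)) {-1..1}"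
    by simp
  from has_integral_mult_right[OF this, of "2 powr (p + q)"]
  have "((\<lambda>t. 2 powr (p + q) * ((t / 2 + 1 / 2) powr q * (1 - (t / 2 + 1 / 2)) powr p))
          has_integral 2 powr (p + q) * (2 * Beta (q + 1) (p + 1))) {-1..1}" .
  also have "2 powr (p + q) * (2 * Beta (q + 1) (p + 1)) = 2 powr (p + q + 1) * Beta (p + 1) (q + 1)"
    by (simp add: powr_add Beta_commute)
  finally have *: "((\<lambda>t. 2 powr (p + q) * ((t / 2 + 1 / 2) powr q * (1 - (t / 2 + 1 / 2)) powr p))
          has_integral 2 powr (p + q + 1) * Beta (p + 1) (q + 1)) {-1..1}" .
  have "2 powr (p + q) * ((t / 2 + 1 / 2) powr q * (1 - (t / 2 + 1 / 2)) powr p)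
      = (1 - t) powr p * (1 + t) powr q" if "t \<in> {-1..1}" for t
  proof -
    have "(2 * (t / 2 + 1 / 2)) powr q = 2 powr q * (t / 2 + 1 / 2) powr q"
      by (rule powr_mult)
    moreover have "(2 * (1 - (t / 2 + 1 / 2))) powr p = 2 powr p * (1 - (t / 2 + 1 / 2)) powr p"
      by (rule powr_mult)
    moreover have "2 * (t / 2 + 1 / 2) = 1 + t" "2 * (1 - (t / 2 + 1 / 2)) = 1 - t"
      by (simp_all add: field_simps)
    ultimately show ?thesis by (simp add: powr_add algebra_simps)
  qed
  then show ?thesis by (rule has_integral_eq[OF _ *])
qed

section \<open>Jacobi polynomials and the Jacobi weight\<close>

lemma poly_jacobi_poly:
  "poly (jacobi_poly n a b) t = (\<Sum>s\<le>n. ((real n + a) gchoose (n - s)) *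
     ((real n + b) gchoose s) * ((t - 1) ^ s * (1 + t) ^ (n - s))) / 2 ^ n"
  by (simp add: jacobi_poly_def poly_sum add.commute)

lemma poly_jacobi_poly_1: "poly (jacobi_poly n a b) 1 = (real n + a) gchoose n"
  by (simp add: poly_jacobi_poly power_0_left sum.atMost_shift)

lemma poly_jacobi_poly_minus_1:
  "poly (jacobi_poly n a b) (-1) = (-1) ^ n * ((real n + b) gchoose n)"
proof -
  have "poly (jacobi_poly n a b) (-1) = (\<Sum>s\<le>n. if s = n then
      ((real n + b) gchoose n) * (-2) ^ n else 0) / 2 ^ n"
    unfolding poly_jacobi_poly by (intro arg_cong2[where f = "(/)"] sum.cong) auto
  then show ?thesis by (simp add: power_minus')
qed

text \<open>Every product of linear factors in the definition is monic of degree n, so the top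
  coefficient is a Vandermonde convolution.\<close>

lemma coeff_jacobi_poly_top:
  "coeff (jacobi_poly n a b) n = ((2 * real n + a + b) gchoose n) / 2 ^ n"
proof -
  have "coeff ([:-1, 1:] ^ s * [:1, 1::real:] ^ (n - s)) n = 1" if "s \<le> n" for s
  proof -
    have "degree ([:-1, 1:] ^ s * [:1, 1::real:] ^ (n - s)) = n"
      using that by (simp add: degree_mult_eq degree_linear_power)
    moreover have "lead_coeff ([:-1, 1:] ^ s * [:1, 1::real:] ^ (n - s)) = 1"
      by (simp add: lead_coeff_mult lead_coeff_power)
    ultimately show ?thesis by simp
  qed
  then have "coeff (jacobi_poly n a b) n
      = (\<Sum>s\<le>n. ((real n + b) gchoose s) * ((real n + a) gchoose (n - s))) / 2 ^ n"
    by (simp add: jacobi_poly_def coeff_sum mult.commute)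
  also have "\<dots> = ((2 * real n + a + b) gchoose n) / 2 ^ n"
    using gbinomial_Vandermonde[of "real n + b" "real n + a" n]
    by (simp add: atLeast0AtMost algebra_simps)
  finally show ?thesis .
qed

lemma degree_jacobi_poly_le: "degree (jacobi_poly n a b) \<le> n"
  unfolding jacobi_poly_def
proof (rule order_trans[OF degree_smult_le], rule degree_sum_le)
  fix s assume "s \<in> {..n}"
  then have "degree ([:-1, 1:] ^ s * [:1, 1::real:] ^ (n - s)) = n"
    by (simp add: degree_mult_eq degree_linear_power)
  then show "degree (smult (((real n + a) gchoose (n - s)) * ((real n + b) gchoose s))
      ([:-1, 1:] ^ s * [:1, 1:] ^ (n - s))) \<le> n"
    using degree_smult_le by metis
qed simp

text \<open>The assumptions keep both Gamma arguments positive, hence away from the poles.\<close>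

lemma gbinomial_add_Gamma:
  fixes a :: real
  assumes "a > -1" "k \<le> n"
  shows "(real n + a) gchoose k = Gamma (real n + a + 1) / (fact k * Gamma (real (n - k) + a + 1))"
proof -
  have "real n + a + 1 > 0" using assms by simp
  then show ?thesis
    using assms by (subst gbinomial_Gamma) (auto simp: of_nat_diff algebra_simps nonpos_Ints_def)
qed

text \<open>Integrated termwise, the explicit form gives Beta values. Their Gamma factors cancel
  against those of the coefficients, except for a factor 1 / (a + s), which leaves the alternating
  binomial sum above. The value determines the quadrature weight at 1.\<close>

lemma jacobi_poly_integral:
  fixes a b :: real
  assumes a: "a > 0" and b: "b > -1"
  shows "((\<lambda>t. (1 - t) powr (a - 1) * (1 + t) powr b * poly (jacobi_poly N a b) t) has_integral
     2 powr (a + b) * (Gamma (real N + b + 1) * Gamma a / Gamma (real N + a + b + 1))) {-1..1}"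
proof -
  \<comment> \<open>The sign comes from rewriting (t - 1)^s as (-1)^s (1 - t)^s, so that the power
    merges with the weight.\<close>
  define c where "c s = ((real N + a) gchoose (N - s)) * ((real N + b) gchoose s) * (-1) ^ s / 2 ^ N" for s
  have G: "Gamma y > 0" if "y > 0" for y :: real
    using that by (rule Gamma_real_pos)
  have "((\<lambda>t. \<Sum>s\<le>N. c s * ((1 - t) powr (a - 1 + real s) * (1 + t) powr (b + real (N - s))))
      has_integral (\<Sum>s\<le>N. c s * (2 powr ((a - 1 + real s) + (b + real (N - s)) + 1)
        * Beta ((a - 1 + real s) + 1) ((b + real (N - s)) + 1)))) {-1..1}"
    by (intro has_integral_sum has_integral_mult_right has_integral_Beta_symmetric)
      (use a b in auto)
  also have "(\<Sum>s\<le>N. c s * (2 powr ((a - 1 + real s) + (b + real (N - s)) + 1)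
        * Beta ((a - 1 + real s) + 1) ((b + real (N - s)) + 1)))
    = (\<Sum>s\<le>N. 2 powr (a + b) * (Gamma (real N + a + 1) * Gamma (real N + b + 1)
        / (fact N * Gamma (real N + a + b + 1))) * ((-1) ^ s * real (N choose s) / (a + real s)))"
  proof (rule sum.cong[OF refl])
    fix s assume "s \<in> {..N}"
    then have s: "s \<le> N" by simp
    have e: "(a - 1 + real s) + (b + real (N - s)) + 1 = a + b + real N"
      "(a - 1 + real s) + 1 = a + real s" "(b + real (N - s)) + 1 = real (N - s) + b + 1"
      using s by (simp_all add: of_nat_diff)
    have p: "2 powr (a + b + real N) = 2 powr (a + b) * 2 ^ N"
      by (simp add: powr_add powr_realpow)
    have ga: "(real N + a) gchoose (N - s)
        = Gamma (real N + a + 1) / (fact (N - s) * ((a + real s) * Gamma (a + real s)))"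
      using a s Gamma_plus1[of "a + real s"]
      by (subst gbinomial_add_Gamma) (auto simp: add_ac nonpos_Ints_def)
    have gb: "(real N + b) gchoose s
        = Gamma (real N + b + 1) / (fact s * Gamma (real (N - s) + b + 1))"
      using b s by (subst gbinomial_add_Gamma) auto
    have bi: "real (N choose s) = fact N / (fact s * fact (N - s))"
      using s by (rule binomial_fact)
    have beta: "Beta (a + real s) (real (N - s) + b + 1)
        = Gamma (a + real s) * Gamma (real (N - s) + b + 1) / Gamma (real N + a + b + 1)"
      using s by (simp add: Beta_def of_nat_diff add_ac)
    have pos: "Gamma (a + real s) > 0" "Gamma (real (N - s) + b + 1) > 0"
       "Gamma (real N + a + b + 1) > 0" "a + real s > 0"
      using a b by (auto intro!: G)
    have alg: "A / (f1 * (d * u)) * (B / (f2 * v)) * m / P * (T * P * (u * v / D))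
        = T * (A * B / (F * D)) * (m * (F / (f2 * f1)) / d)"
      if "u > 0" "v > 0" "D > 0" "d > 0" "P > 0" "F > 0" "f1 > 0" "f2 > 0"
      for A B D F P T d f1 f2 m u v :: real
      using that by (simp add: divide_simps)
    show "c s * (2 powr ((a - 1 + real s) + (b + real (N - s)) + 1)
        * Beta ((a - 1 + real s) + 1) ((b + real (N - s)) + 1))
      = 2 powr (a + b) * (Gamma (real N + a + 1) * Gamma (real N + b + 1)
        / (fact N * Gamma (real N + a + b + 1))) * ((-1) ^ s * real (N choose s) / (a + real s))"
      unfolding e p c_def ga gb bi beta by (rule alg) (use pos in simp_all)
  qed
  also have "\<dots> = 2 powr (a + b) * (Gamma (real N + a + 1) * Gamma (real N + b + 1)
        / (fact N * Gamma (real N + a + b + 1))) * (fact N / pochhammer a (N + 1))"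
    unfolding sum_distrib_left [symmetric] sum_alternating_binomial_divide[OF a] ..
  also have "\<dots> = 2 powr (a + b) * (Gamma (real N + b + 1) * Gamma a / Gamma (real N + a + b + 1))"
  proof -
    have "a \<notin> \<int>\<^sub>\<le>\<^sub>0" using a by (auto simp: nonpos_Ints_def)
    then have "pochhammer a (N + 1) = Gamma (real N + a + 1) / Gamma a"
      using pochhammer_Gamma[of a "N + 1"] by (simp add: add_ac)
    moreover have "Gamma (real N + a + 1) > 0" "Gamma a > 0" using a by (auto intro!: G)
    ultimately show ?thesis by simp
  qed
  finally have *: "((\<lambda>t. \<Sum>s\<le>N. c s * ((1 - t) powr (a - 1 + real s) * (1 + t) powr (b + real (N - s))))
      has_integral 2 powr (a + b) * (Gamma (real N + b + 1) * Gamma a / Gamma (real N + a + b + 1))) {-1..1}" .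
  have "(1 - t) powr (a - 1) * (1 + t) powr b * poly (jacobi_poly N a b) t
      = (\<Sum>s\<le>N. c s * ((1 - t) powr (a - 1 + real s) * (1 + t) powr (b + real (N - s))))" (is "?f t = ?g t")
    if "t \<in> {-1..1}" for t
  proof -
    \<comment> \<open>At y = 0 both sides vanish because \<open>0 powr d = 0\<close> for every d, so
      the identity of integrands holds at the endpoints too.\<close>
    have shift: "y powr (d + real k) = y powr d * y ^ k" if "y \<ge> 0" for y d :: real and k
      using that by (cases "y = 0") (auto simp: powr_add powr_realpow)
    have neg: "(t - 1) ^ s = (-1) ^ s * (1 - t) ^ s" for s
      by (simp flip: power_mult_distrib)
    show ?thesis
      using that unfolding poly_jacobi_poly sum_divide_distrib sum_distrib_left
      by (intro sum.cong refl) (simp add: shift neg c_def del: of_nat_diff)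
  qed
  then have "?g t = ?f t" if "t \<in> {-1..1}" for t using that by simp
  then show ?thesis by (rule has_integral_eq[OF _ *])
qed

text \<open>The integrand is the derivative of \<open>F\<close> on the open interval, and
  \<open>F\<close> vanishes at both endpoints because its exponents are positive. Continuity of
  \<open>F\<close> up to the endpoints suffices, so an unbounded integrand does no harm.\<close>

lemma jacobi_weight_integral_derivative:
  fixes \<alpha> \<beta> :: real and g :: "real poly"
  assumes "\<alpha> > -1" "\<beta> > -1"
  shows "((\<lambda>t. (1 - t) powr \<alpha> * (1 + t) powr \<beta> *
      poly ([:1, 0, -1:] * pderiv g + [:\<beta> - \<alpha>, - (\<alpha> + \<beta> + 2):] * g) t) has_integral 0) {-1..1}"
proof -
  define F where "F t = (1 - t) powr (\<alpha> + 1) * (1 + t) powr (\<beta> + 1) * poly g t" for t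
  have "((\<lambda>t. (1 - t) powr \<alpha> * (1 + t) powr \<beta> *
      poly ([:1, 0, -1:] * pderiv g + [:\<beta> - \<alpha>, - (\<alpha> + \<beta> + 2):] * g) t) has_integral F 1 - F (-1)) {-1..1}"
  proof (rule fundamental_theorem_of_calculus_interior)
    show "continuous_on {-1..1} F"
      unfolding F_def using assms
      by (intro continuous_intros continuous_on_powr') auto
    fix t :: real assume t: "t \<in> {-1<..<1}"
    have "(F has_real_derivative
        (1 - t) powr (\<alpha> + 1) * (1 + t) powr (\<beta> + 1) * poly (pderiv g) t
        + ((1 - t) powr (\<alpha> + 1) * ((\<beta> + 1) * (1 + t) powr \<beta>)
           - ((\<alpha> + 1) * (1 - t) powr \<alpha>) * (1 + t) powr (\<beta> + 1)) * poly g t) (at t)"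
      unfolding F_def using t
      by (auto intro!: derivative_eq_intros simp: algebra_simps)
    moreover have pw: "(1 - t) powr (\<alpha> + 1) = (1 - t) powr \<alpha> * (1 - t)"
       "(1 + t) powr (\<beta> + 1) = (1 + t) powr \<beta> * (1 + t)"
      using t by (simp_all add: powr_add)
    ultimately show "(F has_vector_derivative (1 - t) powr \<alpha> * (1 + t) powr \<beta> *
      poly ([:1, 0, -1:] * pderiv g + [:\<beta> - \<alpha>, - (\<alpha> + \<beta> + 2):] * g) t) (at t)"
      unfolding has_real_derivative_iff_has_vector_derivative [symmetric]
      by (elim DERIV_cong) (simp only: pw, simp add: algebra_simps)
  qed simp
  then show ?thesis by (simp add: F_def)
qed

section \<open>Barycentric weights\<close>

text \<open>In the product rule only the term that differentiates the factor of z survives at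
  z.\<close>

lemma barycentric_weight_pderiv:
  assumes "finite Z" "z \<in> Z"
  shows "barycentric_weight Z z * poly (pderiv (\<Prod>y\<in>Z. [:-y, 1:])) z = 1"
proof -
  have "(\<Prod>y\<in>Z. [:-y, 1:]) = [:-z, 1:] * (\<Prod>y\<in>Z - {z}. [:-y, 1:])"
    using assms by (rule prod.remove)
  then have "poly (pderiv (\<Prod>y\<in>Z. [:-y, 1:])) z = (\<Prod>y\<in>Z - {z}. z - y)"
    by (simp only: pderiv_mult) (simp add: pderiv_pCons poly_prod)
  then show ?thesis
    using assms by (simp add: barycentric_weight_def prod_inversef [symmetric] prod.distrib [symmetric])
qed

text \<open>Exactly the points to the right of z contribute negative factors.\<close>

lemma barycentric_weight_sign:
  assumes "finite Z"
  shows "barycentric_weight Z z = (-1) ^ card {y \<in> Z. z < y} * \<bar>barycentric_weight Z z\<bar>"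
proof -
  have "barycentric_weight Z z
      = (\<Prod>y\<in>Z - {z}. (if z < y then -1 else 1) * \<bar>inverse (z - y)\<bar>)"
    unfolding barycentric_weight_def by (intro prod.cong) (auto simp: divide_simps)
  also have "\<dots> = (\<Prod>y\<in>Z - {z}. if z < y then -1 else 1) * \<bar>barycentric_weight Z z\<bar>"
    by (simp only: prod.distrib barycentric_weight_def abs_prod)
  also have "(\<Prod>y\<in>Z - {z}. if z < y then -1 else (1::real)) = (-1) ^ card {y \<in> Z. z < y}"
  proof -
    have "(\<Prod>y\<in>Z - {z}. if z < y then -1 else (1::real)) = (\<Prod>y\<in>{y \<in> Z. z < y}. -1)"
      using assms by (intro prod.mono_neutral_cong_right) auto
    then show ?thesis by simp
  qed
  finally show ?thesis .
qed

text \<open>The test polynomial \<open>q\<close> that vanishes at all nodes except z and z' has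
  degree \<open>card Z - 2\<close> and leaves only two terms. Its value at z is the reciprocal of (z
  - z') times the barycentric weight of z, and symmetrically at z'; the opposite signs of the two
  differences turn the vanishing sum into an equality.\<close>

lemma annihilating_functional_barycentric:
  fixes \<mu> :: "real \<Rightarrow> real"
  assumes Z: "finite Z" "z \<in> Z" "z' \<in> Z"
    and ann: "\<And>q. degree q + 2 \<le> card Z \<Longrightarrow> (\<Sum>y\<in>Z. \<mu> y * poly q y) = 0"
  shows "\<mu> z * barycentric_weight Z z' = \<mu> z' * barycentric_weight Z z"
proof (cases "z = z'")
  case False
  define q where "q = (\<Prod>y\<in>Z - {z, z'}. [:-y, 1:])"
  have card: "card Z \<ge> 2" "card (Z - {z, z'}) = card Z - 2"
    using Z False card_mono[of Z "{z, z'}"] by (auto simp: card_Diff_subset)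
  have "degree q + 2 \<le> card Z"
    using card by (simp add: q_def degree_prod_sum_eq)
  then have "0 = (\<Sum>y\<in>Z. \<mu> y * poly q y)" by (simp add: ann)
  also have "\<dots> = (\<Sum>y\<in>{z, z'}. \<mu> y * poly q y)"
    using Z by (intro sum.mono_neutral_right) (auto simp: q_def poly_prod)
  finally have q0: "\<mu> z * poly q z + \<mu> z' * poly q z' = 0" using False by simp
  have qz: "poly q u \<noteq> 0" "barycentric_weight Z u = inverse (u - v) * inverse (poly q u)"
    if "u \<in> Z" "v \<in> Z" "u \<noteq> v" "{u, v} = {z, z'}" for u v
  proof -
    show "poly q u \<noteq> 0" using that Z by (auto simp: q_def poly_prod)
    have "Z - {u} = insert v (Z - {u, v})" using that by auto
    moreover have "(\<Prod>y\<in>insert v (Z - {u, v}). inverse (u - y))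
        = inverse (u - v) * (\<Prod>y\<in>Z - {u, v}. inverse (u - y))"
      using Z by (subst prod.insert) auto
    moreover have "poly q u = (\<Prod>y\<in>Z - {u, v}. u - y)"
      using that by (simp add: q_def poly_prod)
    moreover have "(\<Prod>y\<in>Z - {u, v}. inverse (u - y)) = inverse (\<Prod>y\<in>Z - {u, v}. u - y)"
      using prod_inversef[of "\<lambda>y. u - y" "Z - {u, v}"] by (simp add: o_def)
    ultimately show "barycentric_weight Z u = inverse (u - v) * inverse (poly q u)"
      by (simp add: barycentric_weight_def)
  qed
  note 1 = qz[of z z'] and 2 = qz[of z' z]
  have "\<mu> z * poly q z = - (\<mu> z' * poly q z')" using q0 by linarith
  then have "\<mu> z / poly q z' = - (\<mu> z' / poly q z)"
    using 1 2 Z False by (simp add: field_simps insert_commute)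
  then show ?thesis
    using 1 2 Z False by (simp add: insert_commute) (simp add: field_simps)
qed simp

theorem theorem7:
  fixes \<alpha> \<beta> :: real and n :: nat
    and x :: "nat \<Rightarrow> real" and w1 w2 :: real and w :: "nat \<Rightarrow> real"
  assumes "\<alpha> > -1" and "\<beta> > -1"
    and "strict_mono_on {..n} x"
    and "x ` {..n} = {t. poly (jacobi_poly (n + 1) (\<alpha> + 1) (\<beta> + 1)) t = 0}"
    and "gauss_lobatto_rule \<alpha> \<beta> n x w1 w2 w"
  defines "Z \<equiv> {-1, 1} \<union> x ` {..n}"
    and "C \<equiv> bary_const n (\<alpha> + 1) (\<beta> + 1)"
  shows "(\<forall>j\<le>n. barycentric_weight Z (x j) = C * (-1) ^ (j + 1) * sqrt (w j))
    \<and> barycentric_weight Z (-1) = C * sqrt ((\<beta> + 1) * w1)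
    \<and> barycentric_weight Z 1 = C * (-1) ^ n * sqrt ((\<alpha> + 1) * w2)"
proof -
  define a b N where "a = \<alpha> + 1" and "b = \<beta> + 1" and "N = n + 1"
  define P where "P = jacobi_poly N a b"
  define k where "k = coeff P N"
  define X where "X = x ` {..n}"
  define \<Lambda> where "\<Lambda> = barycentric_weight Z"
  have ab: "a > 0" "b > 0" and \<alpha>\<beta>: "\<alpha> = a - 1" "\<beta> = b - 1" "\<alpha> > -1" "\<beta> > -1"
    using assms(1,2) by (simp_all add: a_def b_def)
  have G: "Gamma y > 0" if "y > 0" for y :: real
    using that by (rule Gamma_real_pos)
  have X: "X = {t. poly P t = 0}"
    using assms(4) by (simp add: X_def P_def N_def a_def b_def)
  have inj: "inj_on x {..n}"
    using assms(3) by (rule strict_mono_on_imp_inj_on)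
  have finX: "finite X" and cardX: "card X = N"
    using card_image[OF inj] by (simp_all add: X_def N_def)

  \<comment> \<open>The polynomial P: leading coefficient, endpoint values, factorisation\<close>
  have gk: "k = Gamma (2 * real N + a + b + 1) / (fact N * Gamma (real N + a + b + 1)) / 2 ^ N"
  proof -
    \<comment> \<open>The upper index 2N + a + b is split so that N + a + b plays the role of the
      parameter.\<close>
    have "(real N + (real N + a + b)) gchoose N
        = Gamma (real N + (real N + a + b) + 1) / (fact N * Gamma (real (N - N) + (real N + a + b) + 1))"
      by (rule gbinomial_add_Gamma) (use ab in auto)
    then show ?thesis
      by (simp add: k_def P_def coeff_jacobi_poly_top algebra_simps)
  qed
  have kpos: "k > 0"
    unfolding gk using ab by (intro divide_pos_pos mult_pos_pos G) auto
  have P1: "poly P 1 = Gamma (real N + a + 1) / (fact N * Gamma (a + 1))"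
    using gbinomial_add_Gamma[of a N N] ab by (simp add: P_def poly_jacobi_poly_1)
  have P1pos: "poly P 1 > 0"
    unfolding P1 using ab by (intro divide_pos_pos mult_pos_pos G) auto
  \<comment> \<open>Together with P(1) > 0 this separates the endpoints from the roots, so Z really
    has N + 2 points.\<close>
  have "poly P (-1) \<noteq> 0"
  proof -
    have "(real N + b) gchoose N = Gamma (real N + b + 1) / (fact N * Gamma (b + 1))"
      using gbinomial_add_Gamma[of b N N] ab by simp
    also have "\<dots> > 0" using ab by (intro divide_pos_pos mult_pos_pos G) auto
    finally show ?thesis by (simp add: P_def poly_jacobi_poly_minus_1)
  qed
  with P1pos have notX: "1 \<notin> X" "-1 \<notin> X" by (auto simp: X)
  have Z: "Z = insert (-1) (insert 1 X)" by (auto simp: Z_def X_def)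
  have finZ: "finite Z" and cardZ: "card Z = N + 2"
    using finX cardX notX by (simp_all add: Z)

  have degP: "degree P = N"
    using degree_jacobi_poly_le[of N a b] kpos unfolding P_def k_def
    by (intro order.antisym le_degree) auto
  \<comment> \<open>Both sides have the same coefficient at N and vanish at the N points of X, which
    determines a polynomial of degree at most N.\<close>
  have Pprod: "P = smult k (\<Prod>y\<in>X. [:-y, 1:])"
  proof (rule poly_eqI_degree_lead_coeff[where A = X and n = N])
    show "coeff P N = coeff (smult k (\<Prod>y\<in>X. [:-y, 1:])) N"
      using lead_coeff_prod[of "\<lambda>y. [:-y, 1:]" X] cardX
      by (simp add: k_def degree_prod_sum_eq)
    show "poly P z = poly (smult k (\<Prod>y\<in>X. [:-y, 1:])) z" if "z \<in> X" for z
      using that finX X by (auto simp: poly_prod)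
  qed (use degP cardX in \<open>simp_all add: degree_prod_sum_eq\<close>)

  \<comment> \<open>The bracket is the derivative of (t^2 - 1) P, which is k times the node
    polynomial of Z.\<close>
  have \<Lambda>P: "\<Lambda> z * (2 * z * poly P z + (z\<^sup>2 - 1) * poly (pderiv P) z) = k" if "z \<in> Z" for z
  proof -
    have "(\<Prod>y\<in>Z. [:-y, 1:]) = ([:1, 1:] * [:-1, 1:]) * (\<Prod>y\<in>X. [:-y, 1:])"
      using finX notX by (simp add: Z mult.assoc del: mult_pCons_left mult_pCons_right)
    also have "[:1, 1:] * [:-1, 1:] = [:-1, 0, 1 :: real:]" by simp
    finally have "smult k (\<Prod>y\<in>Z. [:-y, 1:]) = [:-1, 0, 1:] * P"
      unfolding Pprod by (simp only: mult_smult_right)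
    then have "poly (pderiv (smult k (\<Prod>y\<in>Z. [:-y, 1:]))) z = poly (pderiv ([:-1, 0, 1:] * P)) z"
      by simp
    then have eq: "k * poly (pderiv (\<Prod>y\<in>Z. [:-y, 1:])) z
        = 2 * z * poly P z + (z\<^sup>2 - 1) * poly (pderiv P) z"
      by (simp add: pderiv_smult pderiv_mult pderiv_pCons pderiv_diff algebra_simps power2_eq_square)
    show ?thesis
      unfolding eq [symmetric] using barycentric_weight_pderiv[OF finZ that]
      by (simp add: \<Lambda>_def mult.left_commute[of _ k])
  qed
  have \<Lambda>0: "\<Lambda> z \<noteq> 0" if "z \<in> Z" for z
    using \<Lambda>P[OF that] kpos by auto

  \<comment> \<open>The quadrature rule as a sum over Z\<close>
  define W where "W z = (if z = -1 then w1 else if z = 1 then w2 else w (the_inv_into {..n} x z))" for z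
  have W1: "W (-1) = w1" "W 1 = w2" by (simp_all add: W_def)
  have Wx: "W (x j) = w j" if "j \<le> n" for j
  proof -
    have "x j \<in> X" using that by (simp add: X_def)
    then show ?thesis
      using notX that inj by (auto simp: W_def the_inv_into_f_f)
  qed
  have sumZ: "(\<Sum>z\<in>Z. h z) = h (-1) + h 1 + (\<Sum>z\<in>X. h z)" for h :: "real \<Rightarrow> real"
    using finX notX by (simp add: Z)
  have rule: "((\<lambda>t. (1 - t) powr \<alpha> * (1 + t) powr \<beta> * poly f t) has_integral (\<Sum>z\<in>Z. W z * poly f z)) {-1..1}"
    if "degree f \<le> 2 * N + 1" for f
  proof -
    have "(\<Sum>z\<in>X. W z * poly f z) = (\<Sum>j\<le>n. w j * poly f (x j))"
      unfolding X_def by (subst sum.reindex[OF inj]) (simp add: Wx)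
    then show ?thesis
      using assms(5) that by (simp add: gauss_lobatto_rule_def N_def sumZ W1)
  qed

  \<comment> \<open>Quadrature weights against squared barycentric weights\<close>
  define v where "v z = (if z = -1 then b * w1 else if z = 1 then a * w2 else W z)" for z
  \<comment> \<open>The left side is the coefficient of q(z) in the rule applied to L(P q). At -1
    and 1 the derivative term drops out and the linear factor is 2b and -2a, while k /
    \<open>\<Lambda> z\<close> is -2 P(-1) and 2 P(1); this is where the factors b and a in
    \<open>v\<close> come from.\<close>
  have v_eq: "W z * ((1 - z\<^sup>2) * poly (pderiv P) z + (\<beta> - \<alpha> - (\<alpha> + \<beta> + 2) * z) * poly P z)
      = - k * (v z / \<Lambda> z)" if "z \<in> Z" for z
  proof -
    have "- k * (v z / \<Lambda> z) = - (k / \<Lambda> z) * v z" by simp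
    also have "k / \<Lambda> z = 2 * z * poly P z + (z\<^sup>2 - 1) * poly (pderiv P) z"
      using \<Lambda>P[OF that] \<Lambda>0[OF that] by (metis nonzero_mult_div_cancel_left)
    finally have rhs: "- k * (v z / \<Lambda> z) = - (2 * z * poly P z + (z\<^sup>2 - 1) * poly (pderiv P) z) * v z" .
    consider "z = -1" | "z = 1" | "z \<in> X" "z \<noteq> 1" "z \<noteq> -1"
      using \<open>z \<in> Z\<close> notX by (auto simp: Z)
    then show ?thesis
      unfolding rhs by cases (auto simp: v_def W1 \<alpha>\<beta> X algebra_simps)
  qed
  have ann: "(\<Sum>z\<in>Z. (v z / \<Lambda> z) * poly q z) = 0" if "degree q + 2 \<le> card Z" for q
  proof -
    define f where "f = [:1, 0, -1:] * pderiv (P * q) + [:\<beta> - \<alpha>, - (\<alpha> + \<beta> + 2):] * (P * q)"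
    \<comment> \<open>Here deg q is at most N, and L raises the degree by at most one: 2N + 1 = 2n +
      3 is exactly the degree of exactness.\<close>
    have dPq: "degree (P * q) \<le> 2 * N"
      using degree_mult_le[of P q] that degP cardZ by simp
    have "degree ([:1, 0, -1:] * pderiv (P * q)) \<le> 2 * N + 1"
      using degree_mult_le[of "[:1, 0, -1:]" "pderiv (P * q)"] dPq by (auto simp: degree_pderiv N_def)
    moreover have "degree ([:\<beta> - \<alpha>, - (\<alpha> + \<beta> + 2):] * (P * q)) \<le> 2 * N + 1"
      using degree_mult_le[of "[:\<beta> - \<alpha>, - (\<alpha> + \<beta> + 2):]" "P * q"] dPq by (auto split: if_splits)
    ultimately have "degree f \<le> 2 * N + 1" unfolding f_def by (rule degree_add_le)
    from rule[OF this] have "(\<Sum>z\<in>Z. W z * poly f z) = 0"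
      using jacobi_weight_integral_derivative[of \<alpha> \<beta> "P * q"] \<alpha>\<beta>(3,4)
      unfolding f_def by (blast intro: has_integral_unique)
    moreover have "W z * poly f z = - k * ((v z / \<Lambda> z) * poly q z)" if "z \<in> Z" for z
    proof -
      \<comment> \<open>This removes the q' term at every node, so the functional sees only values
        of q.\<close>
      have 0: "(1 - z\<^sup>2) * poly P z = 0" using that by (auto simp: Z X)
      have "poly f z = ((1 - z\<^sup>2) * poly (pderiv P) z
          + (\<beta> - \<alpha> - (\<alpha> + \<beta> + 2) * z) * poly P z) * poly q z + ((1 - z\<^sup>2) * poly P z) * poly (pderiv q) z"
        by (simp add: f_def pderiv_mult power2_eq_square algebra_simps)
      then have "W z * poly f z = (W z * ((1 - z\<^sup>2) * poly (pderiv P) z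
          + (\<beta> - \<alpha> - (\<alpha> + \<beta> + 2) * z) * poly P z)) * poly q z"
        unfolding 0 by simp
      then show ?thesis by (simp only: v_eq[OF that] mult.assoc)
    qed
    ultimately have "- k * (\<Sum>z\<in>Z. (v z / \<Lambda> z) * poly q z) = 0"
      by (simp add: sum_distrib_left)
    then show ?thesis using kpos by simp
  qed
  \<comment> \<open>The node 1 serves as reference because its quadrature weight is computed
    explicitly below.\<close>
  define c where "c = v 1 / (\<Lambda> 1)\<^sup>2"
  have v: "v z = c * (\<Lambda> z)\<^sup>2" if "z \<in> Z" for z
  proof -
    have "1 \<in> Z" by (simp add: Z)
    from annihilating_functional_barycentric[OF finZ that this, of "\<lambda>z. v z / \<Lambda> z"] ann
    have "v z / \<Lambda> z * \<Lambda> 1 = v 1 / \<Lambda> 1 * \<Lambda> z" by (simp add: \<Lambda>_def)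
    then show ?thesis
      using \<Lambda>0[OF that] \<Lambda>0[OF \<open>1 \<in> Z\<close>] by (simp add: c_def field_simps power2_eq_square)
  qed

  \<comment> \<open>The constant of proportionality\<close>
  have \<Lambda>1: "\<Lambda> 1 = k / (2 * poly P 1)"
    using \<Lambda>P[of 1] P1pos by (simp add: Z field_simps)
  \<comment> \<open>The sign of C is (-1)^n, so D is the absolute value of C; signs are restored in
    \<open>Csqrt\<close>.\<close>
  define D where "D = (-1) ^ n * C"
  have w2: "w2 = 2 powr (a + b) * (Gamma (real N + b + 1) * Gamma a / Gamma (real N + a + b + 1)) / (2 * poly P 1)"
  proof -
    \<comment> \<open>(1 + t) P vanishes at every node except 1, and the factor 1 + t raises the
      exponent \<open>\<beta>\<close> to b, giving the integral known for Jacobi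
      polynomials.\<close>
    have "degree ([:1, 1:] * P) \<le> 2 * N + 1"
      using degree_mult_le[of "[:1, 1:]" P] degP by simp
    from rule[OF this] have "((\<lambda>t. (1 - t) powr \<alpha> * (1 + t) powr \<beta> * poly ([:1, 1:] * P) t)
       has_integral w2 * (2 * poly P 1)) {-1..1}"
      by (simp add: sumZ W1 X)
    moreover have eq: "(1 - t) powr (a - 1) * (1 + t) powr b * poly P t
        = (1 - t) powr \<alpha> * (1 + t) powr \<beta> * poly ([:1, 1:] * P) t" if "t \<in> {-1..1}" for t
      using that powr_add[of "1 + t" \<beta> 1] by (cases "t = -1") (simp_all add: \<alpha>\<beta> algebra_simps)
    have "((\<lambda>t. (1 - t) powr \<alpha> * (1 + t) powr \<beta> * poly ([:1, 1:] * P) t)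
       has_integral 2 powr (a + b) * (Gamma (real N + b + 1) * Gamma a / Gamma (real N + a + b + 1))) {-1..1}"
      by (rule has_integral_eq[OF eq jacobi_poly_integral[of a b N, folded P_def]]) (use ab in auto)
    ultimately have "w2 * (2 * poly P 1)
        = 2 powr (a + b) * (Gamma (real N + b + 1) * Gamma a / Gamma (real N + a + b + 1))"
      by (rule has_integral_unique)
    then show ?thesis using P1pos by (subst nonzero_eq_divide_eq) simp_all
  qed
  define E where "E = fact N * Gamma (real N + a + b + 1) * Gamma (real N + a + 1) * Gamma (real N + b + 1)"
  have Epos: "E > 0" unfolding E_def using ab by (intro mult_pos_pos G) auto
  have D: "D = Gamma (2 * real N + a + b + 1) / 2 powr (real N + (a + b + 1) / 2) * (1 / sqrt E)"
  proof -
    have "real N = real n + 1" by (simp add: N_def)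
    then show ?thesis
      unfolding D_def C_def bary_const_def E_def N_def a_def [symmetric] b_def [symmetric]
      by (auto simp: add_ac algebra_simps)
  qed
  have Dpos: "D > 0"
    unfolding D using ab Epos by (intro mult_pos_pos divide_pos_pos G) auto
  have cD: "c * D\<^sup>2 = 1"
  proof -
    have p: "(2 powr (real N + (a + b + 1) / 2))\<^sup>2 = 2 ^ N * 2 ^ N * (2 powr (a + b) * (2::real))"
    proof -
      have "(2 powr (real N + (a + b + 1) / 2))\<^sup>2 = 2 powr (real N + real N + (a + b) + 1)"
        by (simp add: power2_eq_square add.assoc flip: powr_add)
      also have "\<dots> = 2 ^ N * 2 ^ N * (2 powr (a + b) * 2)"
        unfolding powr_add[of _ "real N + real N + (a + b)"] powr_add[of _ "real N + real N"]
          powr_add[of _ "real N" "real N"] by (simp add: powr_realpow)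
      finally show ?thesis .
    qed
    have D2: "D\<^sup>2 = (Gamma (2 * real N + a + b + 1))\<^sup>2 / (2 ^ N * 2 ^ N * (2 powr (a + b) * 2)) / E"
      using Epos unfolding D by (simp add: power_mult_distrib power_divide p)
    have c: "c = a * w2 * (2 * poly P 1)\<^sup>2 / k\<^sup>2"
      using P1pos kpos by (simp add: c_def v_def \<Lambda>1 power_divide)
    have Ga: "Gamma (a + 1) = a * Gamma a"
      using ab Gamma_plus1[of a] by (auto simp: nonpos_Ints_def)
    have pos: "Gamma a > 0" "Gamma (real N + a + 1) > 0" "Gamma (real N + b + 1) > 0"
      "Gamma (real N + a + b + 1) > 0" "Gamma (2 * real N + a + b + 1) > 0"
      using ab by (auto intro!: G)
    \<comment> \<open>Here T is 2 to the power a + b, p is 2^N, F is N!, and g, A, B, H, L are the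
      Gamma values at a, N + a + 1, N + b + 1, N + a + b + 1 and 2N + a + b + 1.\<close>
    have alg: "a * (T * (B * g / H) / (2 * (A / (F * (a * g))))) * (2 * (A / (F * (a * g))))\<^sup>2
        / (L / (F * H) / p)\<^sup>2 * (L\<^sup>2 / (p * p * (T * 2)) / (F * H * A * B)) = 1"
      if "a > 0" "T > 0" "B > 0" "g > 0" "H > 0" "A > 0" "F > 0" "L > 0" "p > 0"
      for a T B g H A F L p :: real
      using that by (simp add: power2_eq_square)
    show ?thesis
      unfolding c D2 w2 P1 gk E_def Ga by (rule alg) (use ab pos in auto)
  qed
  have sqrt_v: "sqrt (v z) = \<bar>\<Lambda> z\<bar> / D" if "z \<in> Z" for z
  proof -
    have "v z = (\<bar>\<Lambda> z\<bar> / D)\<^sup>2"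
      using v[OF that] cD Dpos by (simp add: power_divide field_simps)
    then show ?thesis using Dpos by (simp add: real_sqrt_unique)
  qed
  have Csqrt: "\<Lambda> z = C * (-1) ^ (n + card {y \<in> Z. z < y}) * sqrt (v z)" if "z \<in> Z" for z
  proof -
    have "C = (-1) ^ n * D" by (simp add: D_def)
    then have "C * (-1) ^ (n + card {y \<in> Z. z < y}) * sqrt (v z) = (-1) ^ card {y \<in> Z. z < y} * \<bar>\<Lambda> z\<bar>"
      using Dpos by (simp add: sqrt_v[OF that] power_add)
    then show ?thesis using barycentric_weight_sign[OF finZ, of z] by (simp add: \<Lambda>_def)
  qed

  \<comment> \<open>The roots lie in (-1,1)\<close>
  have cpos: "c > 0"
    using cD Dpos by (metis zero_less_mult_pos2 zero_less_one zero_less_power)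
  have X_interior: "-1 < z \<and> z < 1" if "z \<in> X" for z
  proof -
    define l where "l = (\<Prod>y\<in>X - {z}. [:-y, 1:])"
    have zZ: "z \<in> Z" "z \<noteq> 1" "z \<noteq> -1" using that notX by (auto simp: Z)
    have deg: "degree l = n"
      using that finX cardX by (simp add: l_def degree_prod_sum_eq N_def)
    have "degree ([:1, 0, -1:] * l\<^sup>2) \<le> 2 * N + 1"
      using degree_mult_le[of "[:1, 0, -1:]" "l\<^sup>2"] degree_power_le[of l 2] deg by (simp add: N_def)
    from rule[OF this] have "((\<lambda>t. (1 - t) powr \<alpha> * (1 + t) powr \<beta> * poly ([:1, 0, -1:] * l\<^sup>2) t)
        has_integral (\<Sum>y\<in>X. W y * poly ([:1, 0, -1:] * l\<^sup>2) y)) {-1..1}"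
      by (simp add: sumZ)
    also have "(\<Sum>y\<in>X. W y * poly ([:1, 0, -1:] * l\<^sup>2) y)
        = (\<Sum>y\<in>{z}. W y * poly ([:1, 0, -1:] * l\<^sup>2) y)"
      using that finX by (intro sum.mono_neutral_right) (auto simp: l_def poly_prod)
    also have "\<dots> = W z * (1 - z\<^sup>2) * (poly l z)\<^sup>2"
      by (simp add: power2_eq_square algebra_simps)
    finally have integral: "((\<lambda>t. (1 - t) powr \<alpha> * (1 + t) powr \<beta> * poly ([:1, 0, -1:] * l\<^sup>2) t)
        has_integral W z * (1 - z\<^sup>2) * (poly l z)\<^sup>2) {-1..1}" .
    have "0 \<le> (1 - t) powr \<alpha> * (1 + t) powr \<beta> * poly ([:1, 0, -1:] * l\<^sup>2) t"
      if "t \<in> {-1..1}" for t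
    proof -
      have "poly ([:1, 0, -1:] * l\<^sup>2) t = (1 - t) * (1 + t) * (poly l t)\<^sup>2"
        by (simp add: algebra_simps power2_eq_square)
      then show ?thesis using that by simp
    qed
    with integral have "0 \<le> W z * (1 - z\<^sup>2) * (poly l z)\<^sup>2"
      by (rule has_integral_nonneg)
    moreover have "(poly l z)\<^sup>2 > 0" using finX by (simp add: l_def poly_prod)
    \<comment> \<open>Positivity follows from \<open>v z = c * (\<Lambda> z)\<^sup>2\<close>, which
      was derived without knowing where the roots lie, so the argument is not circular.\<close>
    moreover have "W z > 0" using v[of z] cpos \<Lambda>0[of z] zZ by (simp add: v_def)
    ultimately have "z\<^sup>2 \<le> 1" by (simp add: zero_le_mult_iff)
    then show ?thesis using zZ by (auto simp: abs_square_le_1 abs_le_iff)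
  qed

  \<comment> \<open>Counting the nodes to the right of each node\<close>
  have "\<Lambda> (x j) = C * (-1) ^ (j + 1) * sqrt (w j)" if "j \<le> n" for j
  proof -
    have xX: "x j \<in> X" using that by (simp add: X_def)
    have "{y \<in> Z. x j < y} = insert 1 (x ` {j<..n})"
      using X_interior[OF xX] strict_mono_on_less[OF assms(3)] that by (auto simp: Z X_def)
    moreover have "1 \<notin> x ` {j<..n}" using notX by (auto simp: X_def)
    moreover have "card (x ` {j<..n}) = n - j"
      using inj by (subst card_image) (auto intro: inj_on_subset)
    ultimately have "card {y \<in> Z. x j < y} = n - j + 1" by simp
    moreover have "v (x j) = w j" using xX notX Wx[OF that] by (auto simp: v_def)
    \<comment> \<open>The exponent 2n - j + 1 has the parity of j + 1.\<close>
    moreover have "(-1) ^ (n + (n - j + 1)) = (-1 :: real) ^ (j + 1)"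
      using that by (simp add: minus_one_power_iff)
    ultimately show ?thesis using Csqrt[of "x j"] xX by (simp add: Z)
  qed
  moreover have "\<Lambda> (-1) = C * sqrt ((\<beta> + 1) * w1)"
  proof -
    have "{y \<in> Z. -1 < y} = insert 1 X" using X_interior by (auto simp: Z)
    then have "card {y \<in> Z. -1 < y} = n + 2" using finX cardX notX by (simp add: N_def)
    then show ?thesis using Csqrt[of "-1"] by (simp add: Z v_def b_def)
  qed
  moreover have "\<Lambda> 1 = C * (-1) ^ n * sqrt ((\<alpha> + 1) * w2)"
  proof -
    have "{y \<in> Z. 1 < y} = {}" using X_interior by (force simp: Z)
    then have "card {y \<in> Z. 1 < y} = 0" by (simp only: card.empty)
    then show ?thesis using Csqrt[of 1] by (simp add: Z v_def a_def)
  qed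
  ultimately show ?thesis by (simp add: \<Lambda>_def)
qed

end
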